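(* Let $k,m\in\mathbb N$ with $k>6$ and $m\ge2$. Every good transitive non-cyclic homomorphism $\omega\colon B_k\to S_{mk}$ with $|\mathrm{supp}(\omega(\sigma_1))|=2m$ is standard.
   Context: $B_k$ is the braid group with generators $\sigma_1,\dots,\sigma_{k-1}$ and relations $\sigma_i\sigma_j=\sigma_j\sigma_i$ for $|i-j|\ge2$ and $\sigma_i\sigma_{i+1}\sigma_i=\sigma_{i+1}\sigma_i\sigma_{i+1}$. $S_n$ is the symmetric group on $\{1,\dots,n\}$ acting from the left, so $(\sigma\tau)(x)=\sigma(\tau(x))$; permutations of a subset are extended by the identity. $\mathrm{supp}(s)$ is the set of points moved by a permutation $s$. A homomorphism to $S_n$ is transitive if its image acts transitively on $\{1,\dots,n\}$, and cyclic if its image is a cyclic group. Homomorphisms $\phi,\psi\colon G\to H$ are conjugate if there is $h\in H$ with $\psi(g)=h^{-1}\phi(g)h$ for all $g\in G$. A homomorphism $\omega\colon B_k\to S_n$ is good if one of the following holds: (1) $\mathrm{supp}(\omega(\sigma_i))\cap\mathrm{supp}(\omega(\sigma_j))=\emptyset$ for all $1\le i,j\le k-1$ with $|i-j|>1$; (2) $\mathrm{supp}(\omega(\sigma_1))=\cdots=\mathrm{supp}(\omega(\sigma_{k-1}))$. For $n\ge1$: $\bigtriangledown_n=\{0,\dots,n-1\}$; $|a|_n\in\bigtriangledown_n$ is the residue of $a\in\mathbb Z$ modulo $n$; for $i\ge1$ and $q\in\bigtriangledown_n$ put $a^{(n)}_{i,q}=1+n(i-1)+q$; $A^n_i$ is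 the $n$-cycle $(1+n(i-1),2+n(i-1),\dots,ni)$ (the identity if $n=1$). For a permutation $\sigma$ of $\{j,\dots,j+r-1\}$ and $t_j,\dots,t_{j+r-1}\in\bigtriangledown_n$, $C^{\sigma,n}_{t_j,\dots,t_{j+r-1}}$ is the permutation of $\{n(j-1)+1,\dots,n(j+r-1)\}$ given by $a^{(n)}_{i,q}\mapsto a^{(n)}_{\sigma(i),\,|q+t_{\sigma(i)}|_n}$ for $j\le i\le j+r-1$, $q\in\bigtriangledown_n$. Model homomorphisms $B_k\to S_{mk}$ ($k>6$): For $l\ge1$ and $1\le i\le k-1$, $\psi_l(\sigma_i)\in S_{lk}$ is the $2l$-cycle $(a^{(l)}_{i,0},a^{(l)}_{i+1,0},a^{(l)}_{i,1},a^{(l)}_{i+1,1},\dots,a^{(l)}_{i,l-1},a^{(l)}_{i+1,l-1})$; it is also regarded as a permutation of $\{l(i-1)+1,\dots,l(i+1)\}$. This defines $\psi_m\colon B_k\to S_{mk}$. For $l\mid m$, $1\le l<m$, and a family $t=(t^i_q)$, $1\le i\le k-1$, $(i-1)l+1\le q\le(i+1)l$, of elements of $\bigtriangledown_{m/l}$ satisfying, for all $1\le i\le k-2$ and $j\in\bigtriangledown_l$, $$t^i_{(i-1)l+1+|1+j|_l}+t^i_{il+1+|1+j|_l}\equiv t^{i+1}_{(i+1)l+1+j}+t^{i+1}_{il+1+|1+j|_l}\pmod{m/l},$$ the homomorphism $\phi_{m,l,t}\colon B_k\to S_{mk}$ is given by $$\phi_{m,l,t}(\sigma_i)=A^{m/l}_1\cdots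 A^{m/l}_{(i-1)l}\cdot C^{\psi_l(\sigma_i),m/l}_{t^i_{(i-1)l+1},\dots,t^i_{(i+1)l}}\cdot A^{m/l}_{(i+1)l+1}\cdots A^{m/l}_{kl}.$$ The model homomorphisms are $\psi_m$ and all these $\phi_{m,l,t}$. A homomorphism $B_k\to S_{mk}$ is standard if it is conjugate to one of the model homomorphisms. *)

theory Defs
  imports "HOL-Algebra.Sym_Groups" "HOL-Algebra.Elementary_Groups" "HOL-Number_Theory.Cong"
begin

section \<open>Braid groups\<close>

text \<open>
  The letter \<open>(i, True)\<close> stands for the generator \<open>\<sigma>\<close> with index \<open>i\<close>, and \<open>(i, False)\<close> for its
  inverse. The braid group consists of the classes of words modulo the congruence generated by
  free cancellation and the braid relations.
\<close>

type_synonym braid_word = "(nat \<times> bool) list"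

definition braid_words :: "nat \<Rightarrow> braid_word set" where
  "braid_words k = lists ({1..<k} \<times> UNIV)"

inductive_set braid_rel :: "nat \<Rightarrow> (braid_word \<times> braid_word) set" for k :: nat where
  refl: "u \<in> braid_words k \<Longrightarrow> (u, u) \<in> braid_rel k"
| sym: "(u, v) \<in> braid_rel k \<Longrightarrow> (v, u) \<in> braid_rel k"
| trans: "(u, v) \<in> braid_rel k \<Longrightarrow> (v, w) \<in> braid_rel k \<Longrightarrow> (u, w) \<in> braid_rel k"
| cancel: "u \<in> braid_words k \<Longrightarrow> v \<in> braid_words k \<Longrightarrow> i \<in> {1..<k} \<Longrightarrow>
    (u @ [(i, b), (i, \<not> b)] @ v, u @ v) \<in> braid_rel k"
| commute: "u \<in> braid_words k \<Longrightarrow> v \<in> braid_words k \<Longrightarrow> i \<in> {1..<k} \<Longrightarrow> j \<in> {1..<k} \<Longrightarrow>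
    \<bar>int i - int j\<bar> \<ge> 2 \<Longrightarrow>
    (u @ [(i, True), (j, True)] @ v, u @ [(j, True), (i, True)] @ v) \<in> braid_rel k"
| braid: "u \<in> braid_words k \<Longrightarrow> v \<in> braid_words k \<Longrightarrow> i \<in> {1..<k} \<Longrightarrow> Suc i \<in> {1..<k} \<Longrightarrow>
    (u @ [(i, True), (Suc i, True), (i, True)] @ v,
     u @ [(Suc i, True), (i, True), (Suc i, True)] @ v) \<in> braid_rel k"

definition braid_group :: "nat \<Rightarrow> braid_word set monoid" where
  "braid_group k =
    \<lparr> carrier = braid_words k // braid_rel k,
      mult = (\<lambda>U V. \<Union>u\<in>U. \<Union>v\<in>V. braid_rel k `` {u @ v}),
      one = braid_rel k `` {[]} \<rparr>"

definition braid_gen :: "nat \<Rightarrow> nat \<Rightarrow> braid_word set" where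
  "braid_gen k i = braid_rel k `` {[(i, True)]}"

lemma braid_words_append: "u @ v \<in> braid_words k \<longleftrightarrow> u \<in> braid_words k \<and> v \<in> braid_words k"
  by (auto simp: braid_words_def)

lemma braid_rel_words: "(u, v) \<in> braid_rel k \<Longrightarrow> u \<in> braid_words k \<and> v \<in> braid_words k"
  by (induction rule: braid_rel.induct) (auto simp: braid_words_def)

lemma equiv_braid_rel: "equiv (braid_words k) (braid_rel k)"
proof (rule equivI)
  show "braid_rel k \<subseteq> braid_words k \<times> braid_words k"
    using braid_rel_words by auto
  show "refl_on (braid_words k) (braid_rel k)"
    by (auto simp: refl_on_def intro: braid_rel.refl)
  show "sym (braid_rel k)" by (auto intro: symI braid_rel.sym)
  show "trans (braid_rel k)" by (auto intro: transI braid_rel.trans)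
qed

lemma braid_rel_append_right:
  "(u, v) \<in> braid_rel k \<Longrightarrow> w \<in> braid_words k \<Longrightarrow> (u @ w, v @ w) \<in> braid_rel k"
proof (induction rule: braid_rel.induct)
  case (cancel u v i b)
  then show ?case using braid_rel.cancel[of u k "v @ w" i b] by (simp add: braid_words_append)
next
  case (commute u v i j)
  then show ?case using braid_rel.commute[of u k "v @ w" i j] by (simp add: braid_words_append)
next
  case (braid u v i)
  then show ?case using braid_rel.braid[of u k "v @ w" i] by (simp add: braid_words_append)
qed (auto simp: braid_words_append intro: braid_rel.refl braid_rel.sym braid_rel.trans)

lemma braid_rel_append_left:
  "(u, v) \<in> braid_rel k \<Longrightarrow> w \<in> braid_words k \<Longrightarrow> (w @ u, w @ v) \<in> braid_rel k"
proof (induction rule: braid_rel.induct)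
  case (cancel u v i b)
  then show ?case using braid_rel.cancel[of "w @ u" k v i b] by (simp add: braid_words_append)
next
  case (commute u v i j)
  then show ?case using braid_rel.commute[of "w @ u" k v i j] by (simp add: braid_words_append)
next
  case (braid u v i)
  then show ?case using braid_rel.braid[of "w @ u" k v i] by (simp add: braid_words_append)
qed (auto simp: braid_words_append intro: braid_rel.refl braid_rel.sym braid_rel.trans)

lemma braid_rel_append:
  "(u, u') \<in> braid_rel k \<Longrightarrow> (v, v') \<in> braid_rel k \<Longrightarrow> (u @ v, u' @ v') \<in> braid_rel k"
  by (meson braid_rel.trans braid_rel_append_left braid_rel_append_right braid_rel_words)

lemma braid_mult_classes:
  assumes "u \<in> braid_words k" "v \<in> braid_words k"
  shows "(braid_rel k `` {u}) \<otimes>\<^bsub>braid_group k\<^esub> (braid_rel k `` {v}) = braid_rel k `` {u @ v}"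
proof -
  let ?R = "braid_rel k"
  have eq: "?R `` {u' @ v'} = ?R `` {u @ v}" if "u' \<in> ?R `` {u}" "v' \<in> ?R `` {v}" for u' v'
    using equiv_class_eq[OF equiv_braid_rel braid_rel_append[of u u' k v v']] that by simp
  have "u \<in> ?R `` {u}" "v \<in> ?R `` {v}"
    using assms by (simp_all add: braid_rel.refl)
  then have ne: "?R `` {u} \<noteq> {}" "?R `` {v} \<noteq> {}" by blast+
  have "(\<Union>u'\<in>?R `` {u}. \<Union>v'\<in>?R `` {v}. ?R `` {u' @ v'}) =
        (\<Union>u'\<in>?R `` {u}. \<Union>v'\<in>?R `` {v}. ?R `` {u @ v})"
    by (intro SUP_cong HOL.refl eq)
  also have "\<dots> = ?R `` {u @ v}"
    using ne by (simp only: UN_constant if_False)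
  finally show ?thesis by (simp only: braid_group_def monoid.simps)
qed

lemma group_braid_group: "group (braid_group k)"
proof (rule groupI)
  have nil: "[] \<in> braid_words k" by (simp add: braid_words_def)
  have class_in: "braid_rel k `` {u} \<in> carrier (braid_group k)" if "u \<in> braid_words k" for u
    using that by (simp add: braid_group_def quotientI)
  have class_ex: "\<exists>u\<in>braid_words k. U = braid_rel k `` {u}" if "U \<in> carrier (braid_group k)" for U
    using that by (auto simp: braid_group_def elim: quotientE)
  have one: "\<one>\<^bsub>braid_group k\<^esub> = braid_rel k `` {[]}" by (simp add: braid_group_def)
  show "\<one>\<^bsub>braid_group k\<^esub> \<in> carrier (braid_group k)"
    using one class_in[OF nil] by simp
  fix U assume "U \<in> carrier (braid_group k)"
  then obtain u where u: "u \<in> braid_words k" "U = braid_rel k `` {u}" using class_ex by blast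
  show "\<one>\<^bsub>braid_group k\<^esub> \<otimes>\<^bsub>braid_group k\<^esub> U = U"
    using braid_mult_classes[OF nil u(1)] u(2) one by simp
  have "\<exists>v\<in>braid_words k. (v @ u, []) \<in> braid_rel k"
    using u(1)
  proof (induction u)
    case Nil
    then show ?case using nil braid_rel.refl by (intro bexI[of _ "[]"]) auto
  next
    case (Cons a u)
    obtain i b where a: "a = (i, b)" by (cases a)
    have i: "i \<in> {1..<k}" and uw: "u \<in> braid_words k"
      using Cons.prems a by (auto simp: braid_words_def)
    obtain v where v: "v \<in> braid_words k" "(v @ u, []) \<in> braid_rel k"
      using Cons.IH uw by blast
    have "(v @ [(i, \<not> b), (i, \<not> \<not> b)] @ u, v @ u) \<in> braid_rel k"
      using braid_rel.cancel v(1) uw i by blast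
    then have "((v @ [(i, \<not> b)]) @ a # u, []) \<in> braid_rel k"
      using v(2) a braid_rel.trans by fastforce
    moreover have "v @ [(i, \<not> b)] \<in> braid_words k"
      using v(1) i by (simp add: braid_words_def)
    ultimately show ?case by blast
  qed
  then obtain v where v: "v \<in> braid_words k" "(v @ u, []) \<in> braid_rel k" by blast
  have "(braid_rel k `` {v}) \<otimes>\<^bsub>braid_group k\<^esub> U = \<one>\<^bsub>braid_group k\<^esub>"
    using braid_mult_classes[OF v(1) u(1)] u(2) one equiv_class_eq[OF equiv_braid_rel v(2)] by simp
  then show "\<exists>V\<in>carrier (braid_group k). V \<otimes>\<^bsub>braid_group k\<^esub> U = \<one>\<^bsub>braid_group k\<^esub>"
    using class_in[OF v(1)] by blast
  fix V assume "V \<in> carrier (braid_group k)"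
  then obtain v where v: "v \<in> braid_words k" "V = braid_rel k `` {v}" using class_ex by blast
  show "U \<otimes>\<^bsub>braid_group k\<^esub> V \<in> carrier (braid_group k)"
    using braid_mult_classes[OF u(1) v(1)] u v class_in by (simp add: braid_words_append)
  fix W assume "W \<in> carrier (braid_group k)"
  then obtain w where w: "w \<in> braid_words k" "W = braid_rel k `` {w}" using class_ex by blast
  show "U \<otimes>\<^bsub>braid_group k\<^esub> V \<otimes>\<^bsub>braid_group k\<^esub> W = U \<otimes>\<^bsub>braid_group k\<^esub> (V \<otimes>\<^bsub>braid_group k\<^esub> W)"
    using u v w by (simp add: braid_mult_classes braid_words_append)
qed


section \<open>Properties of homomorphisms to symmetric groups\<close>

definition supp :: "(nat \<Rightarrow> nat) \<Rightarrow> nat set" where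
  "supp s = {x. s x \<noteq> x}"

definition transitive_hom :: "nat \<Rightarrow> ('a, 'b) monoid_scheme \<Rightarrow> ('a \<Rightarrow> nat \<Rightarrow> nat) \<Rightarrow> bool" where
  "transitive_hom n G \<phi> \<longleftrightarrow> (\<forall>x\<in>{1..n}. \<forall>y\<in>{1..n}. \<exists>g\<in>carrier G. \<phi> g x = y)"

definition cyclic_hom ::
  "('a, 'c) monoid_scheme \<Rightarrow> ('b, 'd) monoid_scheme \<Rightarrow> ('a \<Rightarrow> 'b) \<Rightarrow> bool" where
  "cyclic_hom G H \<phi> \<longleftrightarrow> cyclic_group (H\<lparr>carrier := \<phi> ` carrier G\<rparr>)"

definition conjugate_homs ::
  "('a, 'c) monoid_scheme \<Rightarrow> ('b, 'd) monoid_scheme \<Rightarrow> ('a \<Rightarrow> 'b) \<Rightarrow> ('a \<Rightarrow> 'b) \<Rightarrow> bool" where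
  "conjugate_homs G H \<phi> \<psi> \<longleftrightarrow>
    (\<exists>h\<in>carrier H. \<forall>g\<in>carrier G. \<psi> g = inv\<^bsub>H\<^esub> h \<otimes>\<^bsub>H\<^esub> \<phi> g \<otimes>\<^bsub>H\<^esub> h)"

definition good_hom :: "nat \<Rightarrow> (braid_word set \<Rightarrow> nat \<Rightarrow> nat) \<Rightarrow> bool" where
  "good_hom k \<omega> \<longleftrightarrow>
    (\<forall>i\<in>{1..k-1}. \<forall>j\<in>{1..k-1}. \<bar>int i - int j\<bar> > 1 \<longrightarrow>
      supp (\<omega> (braid_gen k i)) \<inter> supp (\<omega> (braid_gen k j)) = {}) \<or>
    (\<forall>i\<in>{1..k-1}. \<forall>j\<in>{1..k-1}. supp (\<omega> (braid_gen k i)) = supp (\<omega> (braid_gen k j)))"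


section \<open>Model homomorphisms\<close>

text \<open>
  \<open>blk n i q\<close> is \<open>a\<^sup>(\<^sup>n\<^sup>)\<^sub>i\<^sub>,\<^sub>q\<close>, the point at position \<open>q < n\<close> of the \<open>i\<close>-th block of length \<open>n\<close>;
  \<open>A_cyc\<close>, \<open>C_perm\<close>, \<open>psi\<close> and \<open>phi\<close> are intended for block indices \<open>i \<ge> 1\<close>. The library's
  \<open>cycle_of_list\<close> sends each list entry to the next one.
\<close>

definition blk :: "nat \<Rightarrow> nat \<Rightarrow> nat \<Rightarrow> nat" where
  "blk n i q = 1 + n * (i - 1) + q"

definition A_cyc :: "nat \<Rightarrow> nat \<Rightarrow> nat \<Rightarrow> nat" where
  "A_cyc n i = cycle_of_list [1 + n * (i - 1)..<1 + n * i]"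

text \<open>
  \<open>C_perm \<sigma> n j r t\<close> is defined on all of \<open>nat\<close>, as the identity outside
  \<open>{n*(j-1)+1..n*(j+r-1)}\<close>; a point \<open>x \<ge> 1\<close> is decoded as \<open>x = blk n i q\<close> with
  \<open>i = (x - 1) div n + 1\<close> and \<open>q = (x - 1) mod n\<close> (see \<open>C_perm_blk\<close> below).
\<close>

definition C_perm ::
  "(nat \<Rightarrow> nat) \<Rightarrow> nat \<Rightarrow> nat \<Rightarrow> nat \<Rightarrow> (nat \<Rightarrow> nat) \<Rightarrow> nat \<Rightarrow> nat" where
  "C_perm \<sigma> n j r t x =
    (if x \<in> {n * (j - 1) + 1..n * (j + r - 1)}
     then let i = (x - 1) div n + 1; q = (x - 1) mod n
          in blk n (\<sigma> i) ((q + t (\<sigma> i)) mod n)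
     else x)"

lemma C_perm_blk:
  assumes "1 \<le> j" "j \<le> i" "i \<le> j + r - 1" "q < n"
  shows "C_perm \<sigma> n j r t (blk n i q) = blk n (\<sigma> i) ((q + t (\<sigma> i)) mod n)"
proof -
  have "n * (j - 1) \<le> n * (i - 1)" using assms by simp
  moreover have "n * (i - 1) + n = n * i" using assms by (cases i) auto
  moreover have "n * i \<le> n * (j + r - 1)" using assms(3) by simp
  ultimately have "blk n i q \<in> {n * (j - 1) + 1..n * (j + r - 1)}"
    using assms(4) unfolding blk_def atLeastAtMost_iff by linarith
  then show ?thesis
    using assms by (simp add: C_perm_def blk_def)
qed

definition psi :: "nat \<Rightarrow> nat \<Rightarrow> nat \<Rightarrow> nat" where
  "psi l i = cycle_of_list (concat (map (\<lambda>q. [blk l i q, blk l (i + 1) q]) [0..<l]))"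

definition comp_list :: "('a \<Rightarrow> 'a) list \<Rightarrow> 'a \<Rightarrow> 'a" where
  "comp_list fs = foldr (\<circ>) fs id"

definition phi :: "nat \<Rightarrow> nat \<Rightarrow> nat \<Rightarrow> (nat \<Rightarrow> nat \<Rightarrow> nat) \<Rightarrow> nat \<Rightarrow> nat \<Rightarrow> nat" where
  "phi k m l t i =
    comp_list (map (A_cyc (m div l)) [1..<(i - 1) * l + 1]) \<circ>
    C_perm (psi l i) (m div l) ((i - 1) * l + 1) (2 * l) (t i) \<circ>
    comp_list (map (A_cyc (m div l)) [(i + 1) * l + 1..<k * l + 1])"

definition admissible :: "nat \<Rightarrow> nat \<Rightarrow> nat \<Rightarrow> (nat \<Rightarrow> nat \<Rightarrow> nat) \<Rightarrow> bool" where
  "admissible k m l t \<longleftrightarrow>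
    (\<forall>i\<in>{1..k-1}. \<forall>q\<in>{(i - 1) * l + 1..(i + 1) * l}. t i q < m div l) \<and>
    (\<forall>i\<in>{1..k-2}. \<forall>j<l.
      [t i ((i - 1) * l + 1 + (1 + j) mod l) + t i (i * l + 1 + (1 + j) mod l) =
       t (i + 1) ((i + 1) * l + 1 + j) + t (i + 1) (i * l + 1 + (1 + j) mod l)] (mod (m div l)))"

text \<open>
  A homomorphism on \<open>B\<^sub>k\<close> is determined by its values on the generators, so the model homomorphisms
  are specified by those values.
\<close>

definition model_hom :: "nat \<Rightarrow> nat \<Rightarrow> (braid_word set \<Rightarrow> nat \<Rightarrow> nat) \<Rightarrow> bool" where
  "model_hom k m \<mu> \<longleftrightarrow>
    \<mu> \<in> hom (braid_group k) (sym_group (m * k)) \<and>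
    ((\<forall>i\<in>{1..k-1}. \<mu> (braid_gen k i) = psi m i) \<or>
     (\<exists>l t. l dvd m \<and> 1 \<le> l \<and> l < m \<and> admissible k m l t \<and>
        (\<forall>i\<in>{1..k-1}. \<mu> (braid_gen k i) = phi k m l t i)))"

definition standard_hom :: "nat \<Rightarrow> nat \<Rightarrow> (braid_word set \<Rightarrow> nat \<Rightarrow> nat) \<Rightarrow> bool" where
  "standard_hom k m \<omega> \<longleftrightarrow>
    (\<exists>\<mu>. model_hom k m \<mu> \<and> conjugate_homs (braid_group k) (sym_group (m * k)) \<omega> \<mu>)"

end

theory Submission
  imports Defs
begin

text \<open>
  Equal supports would be all of \<open>{1..m*k}\<close>, which has more than \<open>2 * m\<close> points, so
  non-neighbouring generators have disjoint supports. Inclusion-exclusion, with all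
  \<open>supp (\<omega> \<sigma>\<^sub>i) \<inter> supp (\<omega> \<sigma>\<^sub>i\<^sub>+\<^sub>1)\<close> being of the same size, forces these intersections
  to have \<open>m\<close> elements. Hence \<open>{1..m*k}\<close> is cut into blocks \<open>D\<^sub>1, \<dots>, D\<^sub>k\<close> of size \<open>m\<close> such that
  \<open>supp (\<omega> \<sigma>\<^sub>i)\<close> is the union of \<open>D\<^sub>i\<close> and \<open>D\<^sub>i\<^sub>+\<^sub>1\<close>; the braid relation shows that \<open>\<omega> \<sigma>\<^sub>i\<close>
  exchanges these two blocks and that \<open>\<omega> \<sigma>\<^sub>i\<close> and \<open>\<omega> \<sigma>\<^sub>i\<^sub>+\<^sub>1\<close> have the same square on \<open>D\<^sub>i\<^sub>+\<^sub>1\<close>.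
  Transporting \<open>D\<^sub>1\<close> along the generators identifies all blocks with one set on which the squares
  act as a single permutation; by transitivity that permutation is an \<open>m\<close>-cycle, so \<open>\<omega>\<close> is
  conjugate to \<open>\<psi>\<^sub>m\<close>.
\<close>

section \<open>The cycles of the model homomorphism\<close>

definition psi_list :: "nat \<Rightarrow> nat \<Rightarrow> nat list" where
  "psi_list l i = concat (map (\<lambda>q. [blk l i q, blk l (i + 1) q]) [0..<l])"

text \<open>Indexing the interleaved list by position turns questions about its entries and its
  distinctness into parity arguments: the parity of \<open>j\<close> picks the block,
  \<open>j div 2\<close> the place in it.\<close>

lemma concat_map_pairs_eq:
  "concat (map (\<lambda>q. [a q, b q]) [0..<n]) =
   map (\<lambda>j. if even j then a (j div 2) else b (j div 2)) [0..<2 * n]"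
  by (induction n) auto

lemma cycle_of_list_nth:
  assumes "distinct cs" "j < length cs"
  shows "cycle_of_list cs (cs ! j) = cs ! (Suc j mod length cs)"
proof -
  have "map (cycle_of_list cs) cs = rotate1 cs"
    using cyclic_rotation[OF assms(1), of 1] by simp
  then have "map (cycle_of_list cs) cs ! j = rotate1 cs ! j" by simp
  then show ?thesis using assms(2) by (simp add: nth_rotate1)
qed

lemma blk_eq_iff:
  assumes "q < l" "q' < l" "1 \<le> i" "1 \<le> i'"
  shows "blk l i q = blk l i' q' \<longleftrightarrow> i = i' \<and> q = q'"
proof
  assume "blk l i q = blk l i' q'"
  then have eq: "l * (i - 1) + q = l * (i' - 1) + q'" by (simp add: blk_def)
  have "(l * (i - 1) + q) div l = i - 1" "(l * (i' - 1) + q') div l = i' - 1"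
    using assms by simp_all
  then have "i - 1 = i' - 1" using eq by simp
  then have "i = i'" using assms by linarith
  with eq show "i = i' \<and> q = q'" by simp
qed simp

lemma set_psi_list: "set (psi_list l i) = blk l i ` {..<l} \<union> blk l (i + 1) ` {..<l}"
  by (auto simp: psi_list_def)

lemma length_psi_list: "length (psi_list l i) = 2 * l"
  by (simp add: psi_list_def concat_map_pairs_eq)

lemma distinct_psi_list:
  assumes "1 \<le> i"
  shows "distinct (psi_list l i)"
proof -
  have "inj_on (\<lambda>j. if even j then blk l i (j div 2) else blk l (i + 1) (j div 2)) {0..<2 * l}"
  proof (rule inj_onI)
    fix x y
    assume xy: "x \<in> {0..<2 * l}" "y \<in> {0..<2 * l}"
      and eq: "(if even x then blk l i (x div 2) else blk l (i + 1) (x div 2)) =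
        (if even y then blk l i (y div 2) else blk l (i + 1) (y div 2))"
    have "x div 2 < l" "y div 2 < l" using xy by auto
    then have "even x = even y \<and> x div 2 = y div 2"
      using eq assms by (auto simp: blk_eq_iff split: if_splits)
    then show "x = y" by (metis div_mult_mod_eq even_iff_mod_2_eq_zero odd_iff_mod_2_eq_one)
  qed
  then show ?thesis
    unfolding psi_list_def concat_map_pairs_eq distinct_map by simp
qed

lemma psi_blk:
  assumes "1 \<le> i" "q < l"
  shows "psi l i (blk l i q) = blk l (i + 1) q"
    and "psi l i (blk l (i + 1) q) = blk l i ((q + 1) mod l)"
proof -
  have psi: "psi l i = cycle_of_list (psi_list l i)" by (simp add: psi_def psi_list_def)
  have even_nth: "psi_list l i ! (2 * j) = blk l i j" if "j < l" for j
    using that by (simp add: psi_list_def concat_map_pairs_eq)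
  have odd_nth: "psi_list l i ! (Suc (2 * j)) = blk l (i + 1) j" if "j < l" for j
    using that by (simp add: psi_list_def concat_map_pairs_eq)
  have "psi l i (psi_list l i ! (2 * q)) = psi_list l i ! (Suc (2 * q) mod (2 * l))"
    unfolding psi using cycle_of_list_nth[OF distinct_psi_list[OF assms(1)]] assms(2)
    by (simp add: length_psi_list)
  then show "psi l i (blk l i q) = blk l (i + 1) q"
    using even_nth odd_nth assms(2) by simp
  have "psi l i (psi_list l i ! (Suc (2 * q))) = psi_list l i ! (Suc (Suc (2 * q)) mod (2 * l))"
    unfolding psi using cycle_of_list_nth[OF distinct_psi_list[OF assms(1)]] assms(2)
    by (simp add: length_psi_list)
  \<comment> \<open>The wrap-around at \<open>q = l - 1\<close>: the successor of an odd position is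
    again an even one, so it lands in block \<open>i\<close> with the place advanced modulo
    \<open>l\<close>.\<close>
  moreover have "Suc (Suc (2 * q)) mod (2 * l) = 2 * ((q + 1) mod l)"
    using mult_mod_right[of 2 "q + 1" l] by simp
  ultimately show "psi l i (blk l (i + 1) q) = blk l i ((q + 1) mod l)"
    using even_nth[of "(q + 1) mod l"] odd_nth assms(2) by simp
qed

lemma psi_fixes:
  assumes "x \<notin> blk l i ` {..<l}" "x \<notin> blk l (i + 1) ` {..<l}"
  shows "psi l i x = x"
proof -
  have "x \<notin> set (psi_list l i)" using assms by (simp add: set_psi_list)
  then show ?thesis unfolding psi_def psi_list_def by (rule id_outside_supp)
qed

section \<open>Supports and intertwining bijections\<close>

text \<open>The second hypothesis says that \<open>t\<close> is the conjugate of \<open>s\<close> by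
  \<open>g\<close>; it is stated without an inverse because braid relations directly produce this
  form.\<close>

lemma supp_conj:
  assumes "bij g" "g \<circ> s = t \<circ> g"
  shows "supp t = g ` supp s"
proof -
  have eq: "t (g x) = g (s x)" for x
    using assms(2) by (metis comp_apply)
  have fix_iff: "t (g x) = g x \<longleftrightarrow> s x = x" for x
    using assms(1) by (simp add: eq bij_is_inj inj_eq)
  show ?thesis
  proof
    show "supp t \<subseteq> g ` supp s"
    proof
      fix y assume "y \<in> supp t"
      moreover obtain x where "y = g x" using assms(1) by (meson bij_pointE)
      ultimately show "y \<in> g ` supp s" using fix_iff by (auto simp: supp_def)
    qed
    show "g ` supp s \<subseteq> supp t" using fix_iff by (auto simp: supp_def)
  qed
qed

lemma supp_closed: "\<lbrakk>inj s; x \<in> supp s\<rbrakk> \<Longrightarrow> s x \<in> supp s"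
  by (simp add: supp_def inj_eq)

section \<open>Braided permutations with disjoint distant supports\<close>

text \<open>Collects what is used about the images \<open>s 1\<close>, ..., \<open>s (k - 1)\<close>
  of the generators, detached from the braid group. \<open>minimal\<close> is transitivity phrased
  as the absence of proper nonempty invariant subsets.\<close>

locale braided_perms =
  fixes s :: "nat \<Rightarrow> nat \<Rightarrow> nat" and k m :: nat
  assumes k_ge: "3 < k" and m_pos: "0 < m"
    and perm: "\<lbrakk>1 \<le> i; i < k\<rbrakk> \<Longrightarrow> s i permutes {1..m * k}"
    and braid: "\<lbrakk>1 \<le> i; i + 1 < k\<rbrakk> \<Longrightarrow> s i \<circ> s (i + 1) \<circ> s i = s (i + 1) \<circ> s i \<circ> s (i + 1)"
    and commute: "\<lbrakk>1 \<le> i; i + 1 < j; j < k\<rbrakk> \<Longrightarrow> s i \<circ> s j = s j \<circ> s i"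
    and disj: "\<lbrakk>1 \<le> i; i + 1 < j; j < k\<rbrakk> \<Longrightarrow> supp (s i) \<inter> supp (s j) = {}"
    and minimal: "\<lbrakk>E \<subseteq> {1..m * k}; E \<noteq> {}; \<And>i. \<lbrakk>1 \<le> i; i < k\<rbrakk> \<Longrightarrow> s i ` E \<subseteq> E\<rbrakk> \<Longrightarrow> E = {1..m * k}"
    and card_supp_1: "card (supp (s 1)) = 2 * m"
begin

lemma bij_s: "\<lbrakk>1 \<le> i; i < k\<rbrakk> \<Longrightarrow> bij (s i)"
  using perm permutes_bij by blast

lemma s_eq_iff: "\<lbrakk>1 \<le> i; i < k\<rbrakk> \<Longrightarrow> s i x = s i y \<longleftrightarrow> x = y"
  using bij_s by (simp add: bij_is_inj inj_eq)

lemma supp_subset: "\<lbrakk>1 \<le> i; i < k\<rbrakk> \<Longrightarrow> supp (s i) \<subseteq> {1..m * k}"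
  unfolding supp_def using perm permutes_not_in by fastforce

lemma finite_supp: "\<lbrakk>1 \<le> i; i < k\<rbrakk> \<Longrightarrow> finite (supp (s i))"
  using supp_subset finite_subset by blast

lemma s_in_supp: "\<lbrakk>1 \<le> i; i < k; x \<in> supp (s i)\<rbrakk> \<Longrightarrow> s i x \<in> supp (s i)"
  by (rule supp_closed[OF bij_is_inj[OF bij_s]])

section \<open>Sizes of the supports and of their intersections\<close>

text \<open>By the braid relation the product of \<open>s i\<close> and \<open>s (i + 1)\<close>
  conjugates \<open>s i\<close> to \<open>s (i + 1)\<close>.\<close>

lemma card_supp_Suc:
  assumes "1 \<le> i" "i + 1 < k"
  shows "card (supp (s (i + 1))) = card (supp (s i))"
proof -
  let ?g = "s i \<circ> s (i + 1)"
  have bij: "bij ?g" using assms bij_s by (simp add: bij_comp)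
  have "supp (s (i + 1)) = ?g ` supp (s i)"
    by (rule supp_conj[OF bij]) (use braid[OF assms] in \<open>simp add: comp_assoc\<close>)
  then show ?thesis
    using bij by (metis bij_is_inj card_image inj_on_subset subset_UNIV)
qed

lemma card_supp:
  assumes "1 \<le> i" "i < k"
  shows "card (supp (s i)) = 2 * m"
  using assms
proof (induction i rule: nat_induct_at_least)
  case base
  then show ?case using card_supp_1 by simp
next
  case (Suc i)
  then show ?case using card_supp_Suc[of i] by simp
qed

text \<open>The product of three consecutive generators conjugates \<open>s i\<close> to
  \<open>s (i + 1)\<close> and \<open>s (i + 1)\<close> to \<open>s (i + 2)\<close> simultaneously,
  hence carries one intersection of supports onto the next.\<close>

lemma card_inter_Suc:
  assumes "1 \<le> i" "i + 2 < k"
  shows "card (supp (s (i + 1)) \<inter> supp (s (i + 2))) = card (supp (s i) \<inter> supp (s (i + 1)))"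
proof -
  let ?g = "s i \<circ> s (i + 1) \<circ> s (i + 2)"
  have bij: "bij ?g" using assms bij_s by (simp add: bij_comp)
  have "?g \<circ> s i = s i \<circ> s (i + 1) \<circ> (s (i + 2) \<circ> s i)" by (simp add: comp_assoc)
  also have "\<dots> = s i \<circ> s (i + 1) \<circ> s i \<circ> s (i + 2)"
    using commute[of i "i + 2"] assms by (simp add: comp_assoc)
  also have "\<dots> = s (i + 1) \<circ> ?g"
    using braid[of i] assms by (simp add: comp_assoc)
  finally have 1: "supp (s (i + 1)) = ?g ` supp (s i)"
    by (rule supp_conj[OF bij])
  have "?g \<circ> s (i + 1) = s i \<circ> (s (i + 1) \<circ> s (i + 2) \<circ> s (i + 1))" by (simp add: comp_assoc)
  also have "\<dots> = s i \<circ> s (i + 2) \<circ> s (i + 1) \<circ> s (i + 2)"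
    using braid[of "i + 1"] assms by (simp add: comp_assoc)
  also have "\<dots> = s (i + 2) \<circ> ?g"
    using commute[of i "i + 2"] assms by (simp add: comp_assoc[symmetric])
  finally have 2: "supp (s (i + 2)) = ?g ` supp (s (i + 1))"
    by (rule supp_conj[OF bij])
  have "supp (s (i + 1)) \<inter> supp (s (i + 2)) = ?g ` (supp (s i) \<inter> supp (s (i + 1)))"
    unfolding image_Int[OF bij_is_inj[OF bij]] using 1 2 by presburger
  then show ?thesis
    using bij by (metis bij_is_inj card_image inj_on_subset subset_UNIV)
qed

lemma card_inter_const:
  assumes "1 \<le> i" "i + 1 < k"
  shows "card (supp (s i) \<inter> supp (s (i + 1))) = card (supp (s 1) \<inter> supp (s 2))"
  using assms
proof (induction i rule: nat_induct_at_least)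
  case base
  then show ?case by (simp add: numeral_2_eq_2)
next
  case (Suc i)
  then show ?case using card_inter_Suc[of i] by simp
qed

text \<open>Each new support meets the union of the earlier ones only in its predecessor, because
  the other earlier supports are disjoint from it; so every step adds \<open>2 * m\<close> points
  minus one common intersection size.\<close>

lemma card_Union_supp:
  assumes "1 \<le> n" "n < k"
  shows "card (\<Union>i\<in>{1..n}. supp (s i)) + (n - 1) * card (supp (s 1) \<inter> supp (s 2)) = n * (2 * m)"
  using assms
proof (induction n rule: nat_induct_at_least)
  case base
  then show ?case using card_supp_1 by simp
next
  case (Suc n)
  let ?U = "\<Union>i\<in>{1..n}. supp (s i)"
  have fin: "finite ?U" "finite (supp (s (Suc n)))"
    using finite_supp Suc by auto
  have "supp (s i) \<inter> supp (s (Suc n)) \<subseteq> supp (s n)" if "i \<in> {1..n}" for i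
    using disj[of i "Suc n"] Suc that by (cases "i = n") auto
  then have "?U \<inter> supp (s (Suc n)) = supp (s n) \<inter> supp (s (Suc n))"
    using Suc by fastforce
  then have "card (?U \<inter> supp (s (Suc n))) = card (supp (s 1) \<inter> supp (s 2))"
    using card_inter_const[of n] Suc by simp
  moreover have "card ?U + card (supp (s (Suc n))) =
      card (?U \<union> supp (s (Suc n))) + card (?U \<inter> supp (s (Suc n)))"
    using card_Un_Int fin by blast
  moreover have "?U \<union> supp (s (Suc n)) = (\<Union>i\<in>{1..Suc n}. supp (s i))"
    using Suc by (auto simp: atLeastAtMostSuc_conv)
  moreover have "card (supp (s (Suc n))) = 2 * m" using card_supp Suc by simp
  moreover have "n * card (supp (s 1) \<inter> supp (s 2)) =
      (n - 1) * card (supp (s 1) \<inter> supp (s 2)) + card (supp (s 1) \<inter> supp (s 2))"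
    using Suc by (cases n) auto
  ultimately show ?case using Suc by simp
qed

text \<open>The union is invariant: each \<open>s i\<close> maps its own support to itself and fixes
  all other points.\<close>

lemma Union_supp: "(\<Union>i\<in>{1..k - 1}. supp (s i)) = {1..m * k}"
proof (rule minimal)
  show "(\<Union>i\<in>{1..k - 1}. supp (s i)) \<subseteq> {1..m * k}"
    using supp_subset by fastforce
  have "supp (s 1) \<noteq> {}" using card_supp_1 m_pos by auto
  then show "(\<Union>i\<in>{1..k - 1}. supp (s i)) \<noteq> {}"
    using k_ge by (auto intro!: bexI[of _ 1])
next
  fix i assume i: "1 \<le> i" "i < k"
  show "s i ` (\<Union>i\<in>{1..k - 1}. supp (s i)) \<subseteq> (\<Union>i\<in>{1..k - 1}. supp (s i))"
  proof (rule image_subsetI)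
    fix x assume x: "x \<in> (\<Union>i\<in>{1..k - 1}. supp (s i))"
    show "s i x \<in> (\<Union>i\<in>{1..k - 1}. supp (s i))"
    proof (cases "x \<in> supp (s i)")
      case True
      then show ?thesis using s_in_supp[OF i] i by (intro UN_I[of i]) auto
    next
      case False
      then show ?thesis using x by (simp add: supp_def)
    qed
  qed
qed

lemma card_inter:
  assumes "1 \<le> i" "i + 1 < k"
  shows "card (supp (s i) \<inter> supp (s (i + 1))) = m"
proof -
  obtain n where n: "k = n + 2" "n > 0"
    using k_ge that[of "k - 2"] by simp
  let ?c = "card (supp (s 1) \<inter> supp (s 2))"
  have "m * k + (k - 2) * ?c = (k - 1) * (2 * m)"
    using card_Union_supp[of "k - 1"] k_ge unfolding Union_supp by (simp add: numeral_2_eq_2)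
  \<comment> \<open>With \<open>k = n + 2\<close> the count reads
    \<open>m * (n + 2) + n * ?c = (n + 1) * (2 * m)\<close>.\<close>
  then have "n * ?c = n * m" using n by (simp add: algebra_simps)
  then show ?thesis using card_inter_const[OF assms] n by simp
qed

section \<open>Blocks and their exchange by the generators\<close>

text \<open>Made symmetric so that the exchange argument covers the left and the right neighbour of
  a generator at once.\<close>

definition nbr :: "nat \<Rightarrow> nat \<Rightarrow> bool" where
  "nbr i j \<longleftrightarrow> 1 \<le> i \<and> i < k \<and> 1 \<le> j \<and> j < k \<and> (j = i + 1 \<or> i = j + 1)"

lemma nbr_braid: "nbr i j \<Longrightarrow> s i (s j (s i x)) = s j (s i (s j x))"
proof -
  assume "nbr i j"
  then consider "1 \<le> i" "i + 1 < k" "j = i + 1" | "1 \<le> j" "j + 1 < k" "i = j + 1"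
    by (auto simp: nbr_def)
  then show ?thesis
  proof cases
    case 1
    from fun_cong[OF braid[OF 1(1,2)], of x] show ?thesis by (simp only: comp_apply 1(3))
  next
    case 2
    from fun_cong[OF braid[OF 2(1,2)], of x] show ?thesis by (simp only: comp_apply 2(3))
  qed
qed

lemma nbr_card_inter: "nbr i j \<Longrightarrow> card (supp (s i) \<inter> supp (s j)) = m"
  using card_inter[of i] card_inter[of j] by (auto simp: nbr_def Int_commute)

lemma nbr_card_diff:
  assumes "nbr i j"
  shows "card (supp (s i) - supp (s j)) = m"
  using assms nbr_card_inter[OF assms] card_supp[of i] finite_supp[of i]
  by (simp add: card_Diff_subset_Int nbr_def)

text \<open>If \<open>s j\<close> fixed both \<open>x\<close> and \<open>s i x\<close>, the braid
  relation at \<open>x\<close> would collapse to \<open>s i (s i x) = s i x\<close>, contradicting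
  that \<open>s i\<close> moves \<open>x\<close>.\<close>

lemma swap_into:
  assumes ij: "nbr i j" and x: "x \<in> supp (s i)" "x \<notin> supp (s j)"
  shows "s i x \<in> supp (s j)"
proof (rule ccontr)
  assume "s i x \<notin> supp (s j)"
  then have fixed: "s j (s i x) = s i x" "s j x = x"
    using x by (simp_all add: supp_def)
  have "s i (s i x) = s i x"
    using nbr_braid[OF ij, of x] by (simp only: fixed)
  then show False using x s_eq_iff[of i "s i x" x] ij by (simp add: supp_def nbr_def)
qed

text \<open>By \<open>swap_into\<close>, \<open>s i\<close> maps
  \<open>supp (s i) - supp (s j)\<close> injectively into
  \<open>supp (s i) \<inter> supp (s j)\<close>. Both have \<open>m\<close> points, so the map is
  onto, and points of the intersection must leave \<open>supp (s j)\<close>.\<close>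

lemma swap:
  assumes ij: "nbr i j" and x: "x \<in> supp (s i)"
  shows "s i x \<in> supp (s j) \<longleftrightarrow> x \<notin> supp (s j)"
proof
  have i: "1 \<le> i" "i < k" using ij by (auto simp: nbr_def)
  have "s i ` (supp (s i) - supp (s j)) = supp (s i) \<inter> supp (s j)"
  proof (rule card_subset_eq)
    show "finite (supp (s i) \<inter> supp (s j))" using finite_supp[OF i] by simp
    show "s i ` (supp (s i) - supp (s j)) \<subseteq> supp (s i) \<inter> supp (s j)"
      using swap_into[OF ij] s_in_supp[OF i] by auto
    have "card (s i ` (supp (s i) - supp (s j))) = card (supp (s i) - supp (s j))"
      by (rule card_image) (simp add: inj_on_def s_eq_iff[OF i])
    then show "card (s i ` (supp (s i) - supp (s j))) = card (supp (s i) \<inter> supp (s j))"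
      using nbr_card_diff[OF ij] nbr_card_inter[OF ij] by simp
  qed
  moreover assume "s i x \<in> supp (s j)"
  ultimately have "s i x \<in> s i ` (supp (s i) - supp (s j))"
    using s_in_supp[OF i x] by simp
  then obtain y where y: "y \<notin> supp (s j)" "s i x = s i y" by blast
  from y(2) have "x = y" by (simp only: s_eq_iff[OF i])
  with y(1) show "x \<notin> supp (s j)" by simp
qed (rule swap_into[OF ij x])

text \<open>Describing a block by the full list of supports containing its points, rather than as an
  intersection of two supports, treats the end blocks \<open>block 1\<close> and
  \<open>block k\<close> like all others.\<close>

definition block :: "nat \<Rightarrow> nat set" where
  "block i = {x. \<forall>j. 1 \<le> j \<and> j < k \<longrightarrow> (x \<in> supp (s j) \<longleftrightarrow> j = i \<or> j + 1 = i)}"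

lemma block_supp:
  "\<lbrakk>x \<in> block i; 1 \<le> j; j < k\<rbrakk> \<Longrightarrow> x \<in> supp (s j) \<longleftrightarrow> j = i \<or> j + 1 = i"
  by (simp add: block_def)

lemma distant_supp:
  assumes "x \<in> supp (s i)" "1 \<le> i" "i < k" "1 \<le> j" "j < k" "j \<noteq> i" "\<not> nbr i j"
  shows "x \<notin> supp (s j)"
proof -
  have "i + 1 < j \<or> j + 1 < i" using assms by (auto simp: nbr_def)
  then show ?thesis using disj[of i j] disj[of j i] assms by blast
qed

text \<open>Applying \<open>s i\<close> keeps a point inside \<open>supp (s i)\<close>, flips its
  membership in the neighbouring supports by \<open>swap\<close>, and keeps it out of the distant
  ones. This turns the membership pattern of block \<open>i\<close> into that of block
  \<open>i + 1\<close>.\<close>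

lemma block_up:
  assumes "x \<in> block i" "1 \<le> i" "i < k"
  shows "s i x \<in> block (i + 1)"
  unfolding block_def
proof (intro CollectI allI impI)
  fix j assume j: "1 \<le> j \<and> j < k"
  have x: "x \<in> supp (s i)" using block_supp assms by simp
  consider "j = i" | "j \<noteq> i" "nbr i j" | "j \<noteq> i" "\<not> nbr i j" by blast
  then show "s i x \<in> supp (s j) \<longleftrightarrow> j = i + 1 \<or> j + 1 = i + 1"
  proof cases
    case 1
    then show ?thesis using s_in_supp x assms by simp
  next
    case 2
    then show ?thesis
      using swap[OF 2(2) x] block_supp[OF assms(1), of j] j by (auto simp: nbr_def)
  next
    case 3
    then show ?thesis
      using distant_supp[OF s_in_supp[OF assms(2,3) x]] j assms by (auto simp: nbr_def)
  qed
qed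

lemma block_down:
  assumes "x \<in> block (i + 1)" "1 \<le> i" "i < k"
  shows "s i x \<in> block i"
  unfolding block_def
proof (intro CollectI allI impI)
  fix j assume j: "1 \<le> j \<and> j < k"
  have x: "x \<in> supp (s i)" using block_supp assms by simp
  consider "j = i" | "j \<noteq> i" "nbr i j" | "j \<noteq> i" "\<not> nbr i j" by blast
  then show "s i x \<in> supp (s j) \<longleftrightarrow> j = i \<or> j + 1 = i"
  proof cases
    case 1
    then show ?thesis using s_in_supp x assms by simp
  next
    case 2
    then show ?thesis
      using swap[OF 2(2) x] block_supp[OF assms(1), of j] j by (auto simp: nbr_def)
  next
    case 3
    then show ?thesis
      using distant_supp[OF s_in_supp[OF assms(2,3) x]] j assms by (auto simp: nbr_def)
  qed
qed

lemma block_subset: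
  assumes "1 \<le> i" "i \<le> k"
  shows "block i \<subseteq> {1..m * k}"
proof
  fix x assume x: "x \<in> block i"
  show "x \<in> {1..m * k}"
  proof (cases "i < k")
    case True
    then show ?thesis using block_supp[OF x, of i] supp_subset[of i] assms by blast
  next
    case False
    then have "x \<in> supp (s (k - 1))" using block_supp[OF x, of "k - 1"] assms k_ge by auto
    moreover have "supp (s (k - 1)) \<subseteq> {1..m * k}" using supp_subset k_ge by auto
    ultimately show ?thesis by blast
  qed
qed

lemma block_1: "block 1 = supp (s 1) - supp (s 2)"
proof
  show "block 1 \<subseteq> supp (s 1) - supp (s 2)"
    using block_supp[of _ 1] k_ge by auto
  show "supp (s 1) - supp (s 2) \<subseteq> block 1"
  proof
    fix x assume x: "x \<in> supp (s 1) - supp (s 2)"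
    show "x \<in> block 1"
      unfolding block_def
    proof (intro CollectI allI impI)
      fix j assume "1 \<le> j \<and> j < k"
      moreover have "j = 1 \<or> j = 2 \<or> 2 < j" if "1 \<le> j" using that by linarith
      ultimately show "x \<in> supp (s j) \<longleftrightarrow> j = 1 \<or> j + 1 = 1"
        using x disj[of 1 j] by auto
    qed
  qed
qed

lemma card_block_1: "card (block 1) = m"
  unfolding block_1 by (rule nbr_card_diff) (use k_ge in \<open>simp add: nbr_def\<close>)

text \<open>Here \<open>s i x\<close> is fixed by \<open>s (i + 1)\<close> and
  \<open>s (i + 1) x\<close> is fixed by \<open>s i\<close>, so each side of the braid relation at
  \<open>x\<close> reduces to a square.\<close>

lemma square_eq:
  assumes "1 \<le> i" "i + 1 < k" "x \<in> block (i + 1)"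
  shows "s (i + 1) (s (i + 1) x) = s i (s i x)"
proof -
  have "s i x \<in> block i" "s (i + 1) x \<in> block (i + 2)"
    using block_down[of x i] block_up[of x "i + 1"] assms by auto
  then have "s i x \<notin> supp (s (i + 1))" "s (i + 1) x \<notin> supp (s i)"
    using block_supp[of "s i x" i "i + 1"] block_supp[of "s (i + 1) x" "i + 2" i] assms by auto
  then have fixed: "s (i + 1) (s i x) = s i x" "s i (s (i + 1) x) = s (i + 1) x"
    by (simp_all add: supp_def)
  have "nbr i (i + 1)" using assms by (simp add: nbr_def)
  from nbr_braid[OF this, of x] show ?thesis by (simp only: fixed)
qed

section \<open>Carrying one orbit through all blocks\<close>

definition base :: nat where
  "base = (SOME x. x \<in> block 1)"

lemma base_block: "base \<in> block 1"
proof -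
  have "block 1 \<noteq> {}" using card_block_1 m_pos by auto
  then show ?thesis unfolding base_def by (simp add: some_in_eq)
qed

text \<open>
  \<open>pt i q\<close> is the image under the conjugating permutation of the point \<open>blk m (i + 1) q\<close>: the
  generators \<open>s 1, s 2, \<dots>\<close> carry the orbit of \<open>base\<close> under the square of \<open>s 1\<close> from block to block.
\<close>

fun pt :: "nat \<Rightarrow> nat \<Rightarrow> nat" where
  "pt 0 q = ((s 1 \<circ> s 1) ^^ q) base"
| "pt (Suc i) q = s (Suc i) (pt i q)"

lemma pt_block:
  assumes "i < k"
  shows "pt i q \<in> block (i + 1)"
  using assms
proof (induction i)
  case 0
  have "s 1 (s 1 x) \<in> block 1" if "x \<in> block 1" for x
    using block_down[of "s 1 x" 1] block_up[of x 1] that k_ge by simp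
  then show ?case using base_block by (induction q) auto
next
  case (Suc i)
  then show ?case using block_up[of "pt i q" "Suc i"] by simp
qed

text \<open>Going up and down again is a square of a generator. By \<open>square_eq\<close> it can
  be traded for the square of the preceding generator, and so inductively for the square of
  \<open>s 1\<close>, which raises \<open>q\<close> by one.\<close>

lemma s_pt_down:
  assumes "Suc i < k"
  shows "s (Suc i) (pt (Suc i) q) = pt i (Suc q)"
  using assms
proof (induction i)
  case 0
  then show ?case by simp
next
  case (Suc i)
  have "s (Suc (Suc i)) (pt (Suc (Suc i)) q) = s (Suc i) (s (Suc i) (pt (Suc i) q))"
    using square_eq[of "Suc i" "pt (Suc i) q"] pt_block[of "Suc i" q] Suc.prems by simp
  then show ?case using Suc by simp
qed

lemma s_pt_other:
  assumes "i < k" "1 \<le> j" "j < k" "j \<noteq> i + 1" "j \<noteq> i"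
  shows "s j (pt i q) = pt i q"
  using block_supp[OF pt_block[OF assms(1)] assms(2,3)] assms by (simp add: supp_def)

text \<open>Pigeonhole: the \<open>m + 1\<close> points \<open>pt 0 0\<close>, ...,
  \<open>pt 0 m\<close> lie in the \<open>m\<close>-element first block. The same \<open>p\<close>
  serves every level, since higher levels are images of level \<open>0\<close>.\<close>

lemma pt_periodic:
  obtains p where "0 < p" "\<And>i q. pt i (q + p) = pt i q"
    and "p \<le> m"
proof -
  have inj: "inj (s 1 \<circ> s 1)"
    by (intro inj_compose bij_is_inj bij_s) (use k_ge in simp_all)
  have "pt 0 q \<in> block 1" for q using pt_block[of 0 q] k_ge by simp
  then have "pt 0 ` {..m} \<subseteq> block 1" by blast
  moreover have "finite (block 1)" by (rule card_ge_0_finite) (simp only: card_block_1 m_pos)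
  ultimately have "card (pt 0 ` {..m}) \<le> card (block 1)" by (intro card_mono)
  then have "card (pt 0 ` {..m}) < card {..m}" by (simp only: card_block_1 card_atMost)
  then have "\<not> inj_on (pt 0) {..m}" by (rule pigeonhole)
  then obtain x y where xy: "x \<le> m" "y \<le> m" "x \<noteq> y" "pt 0 x = pt 0 y"
    by (auto simp only: inj_on_def atMost_iff)
  define a b where "a = min x y" and "b = max x y"
  have ab: "a < b" "b \<le> m" using xy(1-3) by (auto simp: a_def b_def)
  have eq: "pt 0 a = pt 0 b" using xy(4) by (cases "x \<le> y") (simp_all add: a_def b_def)
  define p where "p = b - a"
  have b: "b = a + p" "0 < p" "p \<le> m" using ab by (simp_all add: p_def)
  let ?f = "s 1 \<circ> s 1"
  have "(?f ^^ a) ((?f ^^ p) base) = (?f ^^ a) base"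
    using eq[symmetric] by (simp only: pt.simps b funpow_add comp_apply)
  \<comment> \<open>Injectivity cancels the common initial \<open>a\<close> steps, so the orbit
    returns to \<open>base\<close> itself.\<close>
  then have p: "(?f ^^ p) base = base"
    by (rule injD[OF inj_fn[OF inj]])
  have "pt i (q + p) = pt i q" for i q
  proof (induction i)
    case 0
    then show ?case by (simp only: pt.simps funpow_add comp_apply p)
  next
    case (Suc i)
    then show ?case by (simp only: pt.simps)
  qed
  then show ?thesis by (rule that[OF b(2) _ b(3)])
qed

lemma pt_mod_period:
  assumes "\<And>i q. pt i (q + p) = pt i q"
  shows "pt i (q mod p) = pt i q"
proof -
  have "pt i (r + n * p) = pt i r" for r n
  proof (induction n)
    case (Suc n)
    have "pt i (r + Suc n * p) = pt i ((r + n * p) + p)"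
      by (rule arg_cong[of _ _ "pt i"]) simp
    then show ?case using Suc assms by (simp only:)
  qed simp
  from this[of "q mod p" "q div p"] show ?thesis by (simp only: mod_mult_div_eq mod_div_mult_eq)
qed

text \<open>Generator \<open>s j\<close> exchanges levels \<open>j - 1\<close> and \<open>j\<close>
  and fixes the other levels pointwise, so the points form an invariant set and transitivity
  applies.\<close>

lemma pt_range: "(\<Union>i<k. range (pt i)) = {1..m * k}"
proof (rule minimal)
  show "(\<Union>i<k. range (pt i)) \<subseteq> {1..m * k}"
  proof (rule UN_least)
    fix i assume "i \<in> {..<k}"
    then show "range (pt i) \<subseteq> {1..m * k}"
      using pt_block[of i] block_subset[of "i + 1"] by auto
  qed
  have "0 \<in> {..<k}" using k_ge by simp
  then show "(\<Union>i<k. range (pt i)) \<noteq> {}" by blast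
next
  fix j assume j: "1 \<le> j" "j < k"
  show "s j ` (\<Union>i<k. range (pt i)) \<subseteq> (\<Union>i<k. range (pt i))"
  proof (rule image_subsetI)
    fix x assume "x \<in> (\<Union>i<k. range (pt i))"
    then obtain i q where x: "i < k" "x = pt i q" by auto
    consider "j = Suc i" | "j = i" | "j \<noteq> i + 1" "j \<noteq> i" by force
    then have "\<exists>i'<k. \<exists>q'. s j x = pt i' q'"
    proof cases
      case 1
      then show ?thesis using x j by (intro exI[of _ j]) auto
    next
      case 2
      then obtain i' where "i = Suc i'" using j by (cases i) auto
      then show ?thesis using 2 x s_pt_down[of i' q] by (metis Suc_lessD)
    next
      case 3
      then show ?thesis using s_pt_other x j by blast
    qed
    then show "s j x \<in> (\<Union>i<k. range (pt i))" by auto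
  qed
qed

lemma pt_range_period:
  assumes "0 < p" "\<And>i q. pt i (q + p) = pt i q"
  shows "(\<lambda>(i, q). pt i q) ` ({..<k} \<times> {..<p}) = {1..m * k}"
proof -
  have "range (pt i) = pt i ` {..<p}" for i
  proof
    show "range (pt i) \<subseteq> pt i ` {..<p}"
    proof (rule image_subsetI)
      fix q
      show "pt i q \<in> pt i ` {..<p}"
        by (rule image_eqI[of _ _ "q mod p"], rule pt_mod_period[OF assms(2), symmetric])
          (use assms(1) in simp)
    qed
  qed blast
  then have "(\<Union>i<k. pt i ` {..<p}) = {1..m * k}" using pt_range by simp
  moreover have "(\<lambda>(i, q). pt i q) ` ({..<k} \<times> {..<p}) = (\<Union>i<k. pt i ` {..<p})" by force
  ultimately show ?thesis by simp
qed

text \<open>At most \<open>k * p\<close> points cover all \<open>m * k\<close> points, which forces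
  \<open>p = m\<close>: the square of \<open>s 1\<close> acts on the first block as a single
  \<open>m\<close>-cycle.\<close>

lemma pt_period: "pt i (q + m) = pt i q"
proof -
  obtain p where p: "0 < p" "\<And>i q. pt i (q + p) = pt i q" "p \<le> m"
    using pt_periodic by blast
  have "m * k \<le> card ({..<k} \<times> {..<p})"
    using card_image_le[of "{..<k} \<times> {..<p}" "\<lambda>(i, q). pt i q"] pt_range_period[OF p(1,2)] by simp
  then have "m \<le> p" using k_ge by (simp add: mult.commute)
  with p(3) have "p = m" by simp
  with p(2) show ?thesis by blast
qed

section \<open>The conjugating permutation\<close>

definition straighten :: "nat \<Rightarrow> nat" where
  "straighten x = (if x \<in> {1..m * k} then pt ((x - 1) div m) ((x - 1) mod m) else x)"

lemma blk_in: "\<lbrakk>i < k; q < m\<rbrakk> \<Longrightarrow> blk m (Suc i) q \<in> {1..m * k}"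
proof -
  assume "i < k" "q < m"
  then have "m * i + q < m * Suc i" "m * Suc i \<le> m * k"
    by (simp, intro mult_le_mono2) simp
  then show ?thesis by (simp add: blk_def)
qed

lemma blk_cases:
  assumes "x \<in> {1..m * k}"
  obtains i q where "i < k" "q < m" "x = blk m (Suc i) q"
proof
  have "x - 1 < k * m" using assms m_pos k_ge by (auto simp: mult.commute)
  then show "(x - 1) div m < k" by (rule less_mult_imp_div_less)
  show "(x - 1) mod m < m" using m_pos by simp
  show "x = blk m (Suc ((x - 1) div m)) ((x - 1) mod m)"
    using assms by (simp add: blk_def)
qed

lemma straighten_blk: "\<lbrakk>i < k; q < m\<rbrakk> \<Longrightarrow> straighten (blk m (Suc i) q) = pt i q"
  using blk_in[of i q] by (simp add: straighten_def blk_def)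

text \<open>Surjectivity suffices, as a surjection of a finite set onto itself is injective.\<close>

lemma straighten_permutes: "straighten permutes {1..m * k}"
proof (rule bij_imp_permutes)
  have "straighten ` {1..m * k} = {1..m * k}"
  proof
    show "straighten ` {1..m * k} \<subseteq> {1..m * k}"
    proof (rule image_subsetI)
      fix x assume "x \<in> {1..m * k}"
      then obtain i q where "i < k" "q < m" "x = blk m (Suc i) q" by (rule blk_cases)
      then show "straighten x \<in> {1..m * k}" using straighten_blk pt_range by blast
    qed
    show "{1..m * k} \<subseteq> straighten ` {1..m * k}"
    proof
      fix y assume "y \<in> {1..m * k}"
      then have "y \<in> (\<lambda>(i, q). pt i q) ` ({..<k} \<times> {..<m})"
        using pt_range_period[OF m_pos pt_period] by simp
      then obtain i q where "i < k" "q < m" "y = pt i q" by auto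
      then show "y \<in> straighten ` {1..m * k}" using straighten_blk blk_in by (metis image_eqI)
    qed
  qed
  then show "bij_betw straighten {1..m * k} {1..m * k}"
    by (simp add: bij_betw_def eq_card_imp_inj_on)
qed (auto simp: straighten_def)

text \<open>The two rules of \<open>psi_blk\<close> correspond to the recursion of \<open>pt\<close>
  (one level up, same \<open>q\<close>) and to \<open>s_pt_down\<close> (one level down,
  \<open>q\<close> advanced).\<close>

lemma straighten_psi:
  assumes j: "1 \<le> j" "j < k"
  shows "s j \<circ> straighten = straighten \<circ> psi m j"
proof
  fix x
  show "(s j \<circ> straighten) x = (straighten \<circ> psi m j) x"
  proof (cases "x \<in> {1..m * k}")
    case True
    then obtain i q where iq: "i < k" "q < m" "x = blk m (Suc i) q" by (rule blk_cases)
    consider "j = Suc i" | "j = i" | "j \<noteq> i + 1" "j \<noteq> i" by force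
    then show ?thesis
    proof cases
      case 1
      then show ?thesis
        using iq j psi_blk(1)[of j q m] straighten_blk[of i q] straighten_blk[of j q] by simp
    next
      case 2
      then obtain i' where i': "i = Suc i'" using j by (cases i) auto
      \<comment> \<open>The model advances modulo \<open>m\<close>, whereas \<open>pt\<close>
        advances without reduction; the period \<open>m\<close> reconciles them.\<close>
      have "pt i' (Suc q mod m) = pt i' (Suc q)"
        by (rule pt_mod_period) (rule pt_period)
      moreover have "s j (pt i q) = pt i' (Suc q)"
        using s_pt_down[of i' q] iq 2 i' by simp
      ultimately show ?thesis
        using 2 i' iq j psi_blk(2)[of j q m] straighten_blk[of i q] straighten_blk[of i' "Suc q mod m"] m_pos
        by simp
    next
      case 3
      have "x \<notin> blk m j ` {..<m}" "x \<notin> blk m (j + 1) ` {..<m}"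
        using 3 iq j by (auto simp: blk_eq_iff)
      then show ?thesis
        using psi_fixes[of x m j] straighten_blk[of i q] iq s_pt_other[OF iq(1) j 3] by simp
    qed
  next
    case False
    have "blk m j ` {..<m} \<subseteq> {1..m * k}" "blk m (j + 1) ` {..<m} \<subseteq> {1..m * k}"
      using blk_in[of "j - 1"] blk_in[of j] j by auto
    then have "psi m j x = x" using False by (intro psi_fixes) auto
    moreover have "s j x = x" using perm[OF j] False by (meson permutes_not_in)
    moreover have "straighten x = x" using False by (simp only: straighten_def if_False)
    ultimately show ?thesis by (simp only: comp_apply)
  qed
qed

end

section \<open>Homomorphisms from the braid group\<close>

lemma braid_class_in: "u \<in> braid_words k \<Longrightarrow> braid_rel k `` {u} \<in> carrier (braid_group k)"
  by (simp add: braid_group_def quotientI)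

lemma braid_gen_in: "\<lbrakk>1 \<le> i; i < k\<rbrakk> \<Longrightarrow> braid_gen k i \<in> carrier (braid_group k)"
  unfolding braid_gen_def by (rule braid_class_in) (simp add: braid_words_def)

lemma braid_class_Cons:
  assumes "a # u \<in> braid_words k"
  shows "braid_rel k `` {a # u} = (braid_rel k `` {[a]}) \<otimes>\<^bsub>braid_group k\<^esub> (braid_rel k `` {u})"
  using braid_mult_classes[of "[a]" k u] assms by (simp add: braid_words_def)

lemma braid_gen_commute:
  assumes "1 \<le> i" "i + 1 < j" "j < k"
  shows "braid_gen k i \<otimes>\<^bsub>braid_group k\<^esub> braid_gen k j = braid_gen k j \<otimes>\<^bsub>braid_group k\<^esub> braid_gen k i"
proof -
  have "([] @ [(i, True), (j, True)] @ [], [] @ [(j, True), (i, True)] @ []) \<in> braid_rel k"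
    using assms by (intro braid_rel.commute) (auto simp: braid_words_def)
  then show ?thesis
    using assms equiv_class_eq[OF equiv_braid_rel]
    by (simp add: braid_gen_def braid_mult_classes braid_words_def)
qed

lemma braid_gen_braid:
  assumes "1 \<le> i" "i + 1 < k"
  shows "braid_gen k i \<otimes>\<^bsub>braid_group k\<^esub> braid_gen k (i + 1) \<otimes>\<^bsub>braid_group k\<^esub> braid_gen k i =
    braid_gen k (i + 1) \<otimes>\<^bsub>braid_group k\<^esub> braid_gen k i \<otimes>\<^bsub>braid_group k\<^esub> braid_gen k (i + 1)"
proof -
  have "([] @ [(i, True), (Suc i, True), (i, True)] @ [],
      [] @ [(Suc i, True), (i, True), (Suc i, True)] @ []) \<in> braid_rel k"
    using assms by (intro braid_rel.braid) (auto simp: braid_words_def)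
  then show ?thesis
    using assms equiv_class_eq[OF equiv_braid_rel]
    by (simp add: braid_gen_def braid_mult_classes braid_words_def)
qed

lemma braid_gen_inverse:
  assumes "1 \<le> i" "i < k"
  shows "braid_gen k i \<otimes>\<^bsub>braid_group k\<^esub> (braid_rel k `` {[(i, False)]}) = \<one>\<^bsub>braid_group k\<^esub>"
proof -
  have "([] @ [(i, True), (i, \<not> True)] @ [], [] @ []) \<in> braid_rel k"
    using assms by (intro braid_rel.cancel) (auto simp: braid_words_def)
  then have "braid_rel k `` {[(i, True), (i, False)]} = braid_rel k `` {[]}"
    using equiv_class_eq[OF equiv_braid_rel] by simp
  then show ?thesis
    using assms braid_mult_classes[of "[(i, True)]" k "[(i, False)]"]
    by (simp add: braid_gen_def braid_words_def) (simp add: braid_group_def)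
qed

locale braid_hom =
  fixes k n :: nat and \<omega> :: "braid_word set \<Rightarrow> nat \<Rightarrow> nat"
  assumes hom: "\<omega> \<in> hom (braid_group k) (sym_group n)"
begin

lemma hom_mult:
  "\<lbrakk>x \<in> carrier (braid_group k); y \<in> carrier (braid_group k)\<rbrakk> \<Longrightarrow>
    \<omega> (x \<otimes>\<^bsub>braid_group k\<^esub> y) = \<omega> x \<circ> \<omega> y"
  using hom_mult[OF hom] by (simp add: sym_group_mult)

lemma hom_one: "\<omega> \<one>\<^bsub>braid_group k\<^esub> = id"
  using Group.hom_one[OF hom group_braid_group sym_group_is_group] by (simp add: sym_group_one)

lemma gen_permutes: "\<lbrakk>1 \<le> i; i < k\<rbrakk> \<Longrightarrow> \<omega> (braid_gen k i) permutes {1..n}"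
  using hom_in_carrier[OF hom braid_gen_in] by (simp add: sym_group_carrier)

lemma gen_commute:
  assumes "1 \<le> i" "i + 1 < j" "j < k"
  shows "\<omega> (braid_gen k i) \<circ> \<omega> (braid_gen k j) = \<omega> (braid_gen k j) \<circ> \<omega> (braid_gen k i)"
  using arg_cong[OF braid_gen_commute[OF assms], of \<omega>] assms by (simp add: hom_mult braid_gen_in)

lemma gen_braid:
  assumes "1 \<le> i" "i + 1 < k"
  shows "\<omega> (braid_gen k i) \<circ> \<omega> (braid_gen k (i + 1)) \<circ> \<omega> (braid_gen k i) =
    \<omega> (braid_gen k (i + 1)) \<circ> \<omega> (braid_gen k i) \<circ> \<omega> (braid_gen k (i + 1))"
proof -
  interpret group "braid_group k" by (rule group_braid_group)
  show ?thesis
    using arg_cong[OF braid_gen_braid[OF assms], of \<omega>] assms by (simp add: hom_mult braid_gen_in)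
qed

lemma gen_inverse:
  assumes "1 \<le> i" "i < k"
  shows "\<omega> (braid_gen k i) \<circ> \<omega> (braid_rel k `` {[(i, False)]}) = id"
proof -
  have "braid_rel k `` {[(i, False)]} \<in> carrier (braid_group k)"
    using assms by (intro braid_class_in) (simp add: braid_words_def)
  then show ?thesis
    using arg_cong[OF braid_gen_inverse[OF assms], of \<omega>] assms
    by (simp add: hom_mult hom_one braid_gen_in)
qed

text \<open>Transitivity speaks of all group elements, whereas invariance is checked on generators
  only; induction over words bridges the two.\<close>

lemma invariant_set:
  assumes "finite E" and E: "\<And>i. \<lbrakk>1 \<le> i; i < k\<rbrakk> \<Longrightarrow> \<omega> (braid_gen k i) ` E \<subseteq> E"
    and "u \<in> braid_words k"
  shows "\<omega> (braid_rel k `` {u}) ` E \<subseteq> E"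
  using assms(3)
proof (induction u)
  case Nil
  then show ?case using hom_one by (simp add: braid_group_def)
next
  case (Cons a u)
  obtain i b where a: "a = (i, b)" by (cases a)
  have i: "1 \<le> i" "i < k" and u: "u \<in> braid_words k" and a_word: "[a] \<in> braid_words k"
    using Cons.prems a by (auto simp: braid_words_def)
  have step: "\<omega> (braid_rel k `` {[a]}) ` E \<subseteq> E"
  proof (cases b)
    case True
    then show ?thesis using E[OF i] a by (simp add: braid_gen_def)
  next
    case False
    let ?s = "\<omega> (braid_gen k i)"
    have bij: "bij ?s" using gen_permutes[OF i] permutes_bij by blast
    \<comment> \<open>Inverse letters need equality rather than inclusion; it follows from
      injectivity because \<open>E\<close> is finite.\<close>
    have "?s ` E = E"
    proof (rule card_subset_eq[OF assms(1) E[OF i]])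
      show "card (?s ` E) = card E"
        using bij by (metis bij_is_inj card_image inj_on_subset subset_UNIV)
    qed
    show ?thesis
    proof (rule image_subsetI)
      fix x assume "x \<in> E"
      then obtain y where y: "y \<in> E" "x = ?s y" using \<open>?s ` E = E\<close> by blast
      have "?s (\<omega> (braid_rel k `` {[a]}) x) = x"
        using gen_inverse[OF i, THEN fun_cong, of x] a False by simp
      then have "\<omega> (braid_rel k `` {[a]}) x = y"
        using y bij by (metis bij_is_inj injD)
      then show "\<omega> (braid_rel k `` {[a]}) x \<in> E" using y by simp
    qed
  qed
  have "\<omega> (braid_rel k `` {a # u}) = \<omega> (braid_rel k `` {[a]}) \<circ> \<omega> (braid_rel k `` {u})"
    using braid_class_Cons[OF Cons.prems] hom_mult[OF braid_class_in[OF a_word] braid_class_in[OF u]]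
    by simp
  then show ?case using step Cons.IH[OF u] by fastforce
qed

lemma transitive_minimal:
  assumes "transitive_hom n (braid_group k) \<omega>"
    and "E \<subseteq> {1..n}" "E \<noteq> {}"
    and "\<And>i. \<lbrakk>1 \<le> i; i < k\<rbrakk> \<Longrightarrow> \<omega> (braid_gen k i) ` E \<subseteq> E"
  shows "E = {1..n}"
proof (rule antisym[OF assms(2)])
  show "{1..n} \<subseteq> E"
  proof
    fix y assume y: "y \<in> {1..n}"
    obtain x where x: "x \<in> E" using assms(3) by blast
    then obtain g where g: "g \<in> carrier (braid_group k)" "\<omega> g x = y"
      using assms(1,2) y unfolding transitive_hom_def by blast
    then obtain u where u: "u \<in> braid_words k" "g = braid_rel k `` {u}"
      by (auto simp: braid_group_def elim: quotientE)
    have "finite E" using assms(2) finite_subset by blast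
    from invariant_set[OF this assms(4) u(1)] show "y \<in> E" using g u x by blast
  qed
qed

end

section \<open>Conjugate homomorphisms and the classification\<close>

lemma conj_hom:
  assumes "group H" "\<omega> \<in> hom G H" "h \<in> carrier H"
  shows "(\<lambda>g. inv\<^bsub>H\<^esub> h \<otimes>\<^bsub>H\<^esub> \<omega> g \<otimes>\<^bsub>H\<^esub> h) \<in> hom G H"
proof -
  interpret H: group H by fact
  show ?thesis
  proof (rule homI)
    fix x assume "x \<in> carrier G"
    then show "inv\<^bsub>H\<^esub> h \<otimes>\<^bsub>H\<^esub> \<omega> x \<otimes>\<^bsub>H\<^esub> h \<in> carrier H"
      using assms hom_in_carrier by fastforce
  next
    fix x y assume xy: "x \<in> carrier G" "y \<in> carrier G"
    then have car: "\<omega> x \<in> carrier H" "\<omega> y \<in> carrier H" using assms hom_in_carrier by fastforce+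
    have "h \<otimes>\<^bsub>H\<^esub> (inv\<^bsub>H\<^esub> h \<otimes>\<^bsub>H\<^esub> (\<omega> y \<otimes>\<^bsub>H\<^esub> h)) = \<omega> y \<otimes>\<^bsub>H\<^esub> h"
      using car assms(3) by (simp add: H.m_assoc[symmetric])
    then show "inv\<^bsub>H\<^esub> h \<otimes>\<^bsub>H\<^esub> \<omega> (x \<otimes>\<^bsub>G\<^esub> y) \<otimes>\<^bsub>H\<^esub> h =
      inv\<^bsub>H\<^esub> h \<otimes>\<^bsub>H\<^esub> \<omega> x \<otimes>\<^bsub>H\<^esub> h \<otimes>\<^bsub>H\<^esub> (inv\<^bsub>H\<^esub> h \<otimes>\<^bsub>H\<^esub> \<omega> y \<otimes>\<^bsub>H\<^esub> h)"
      using car assms(3) hom_mult[OF assms(2) xy] by (simp add: H.m_assoc)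
  qed
qed

theorem theorem4p1:
  fixes k m :: nat and \<omega> :: "braid_word set \<Rightarrow> nat \<Rightarrow> nat"
  assumes "k > 6" and "m \<ge> 2"
    and "\<omega> \<in> hom (braid_group k) (sym_group (m * k))"
    and "good_hom k \<omega>"
    and "transitive_hom (m * k) (braid_group k) \<omega>"
    and "\<not> cyclic_hom (braid_group k) (sym_group (m * k)) \<omega>"
    and "card (supp (\<omega> (braid_gen k 1))) = 2 * m"
  shows "standard_hom k m \<omega>"
proof -
  interpret braid_hom k "m * k" \<omega> by unfold_locales (rule assms(3))
  let ?s = "\<lambda>i. \<omega> (braid_gen k i)"
  let ?S = "sym_group (m * k)"
  have subset: "supp (?s 1) \<subseteq> {1..m * k}"
    using permutes_not_in[OF gen_permutes[of 1]] assms(1) unfolding supp_def by fastforce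
  have ne: "supp (?s 1) \<noteq> {}" using assms(2,7) by auto
  have not_equal: "\<not> (\<forall>i\<in>{1..k-1}. \<forall>j\<in>{1..k-1}. supp (?s i) = supp (?s j))"
  proof
    assume eq: "\<forall>i\<in>{1..k-1}. \<forall>j\<in>{1..k-1}. supp (?s i) = supp (?s j)"
    have "supp (?s 1) = {1..m * k}"
    proof (rule transitive_minimal[OF assms(5) subset ne])
      fix i assume i: "1 \<le> i" "i < k"
      have "supp (?s 1) = supp (?s i)" using eq i by simp
      moreover have "inj (?s i)" using gen_permutes[OF i] by (rule permutes_inj)
      ultimately show "?s i ` supp (?s 1) \<subseteq> supp (?s 1)"
        using supp_closed by (metis image_subsetI)
    qed
    \<comment> \<open>The support would have \<open>m * k\<close> points, more than
      \<open>2 * m\<close> since \<open>k > 6\<close>.\<close>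
    then show False using assms(1,2,7) by simp
  qed
  interpret braided_perms ?s k m
  proof
    show "3 < k" "0 < m" using assms(1,2) by auto
    show "supp (?s i) \<inter> supp (?s j) = {}" if "1 \<le> i" "i + 1 < j" "j < k" for i j
    proof -
      have "i \<in> {1..k-1}" "j \<in> {1..k-1}" "\<bar>int i - int j\<bar> > 1" using that by auto
      then show ?thesis using assms(4) not_equal unfolding good_hom_def by blast
    qed
  qed (use gen_permutes gen_braid gen_commute transitive_minimal[OF assms(5)] assms(7) in auto)
  have c: "straighten \<in> carrier ?S" using straighten_permutes by (simp add: sym_group_carrier)
  \<comment> \<open>Conjugating by \<open>straighten\<close> in this direction matches
    \<open>conjugate_homs\<close>, and \<open>straighten_psi\<close> then evaluates it on the
    generators.\<close>
  define \<mu> where "\<mu> = (\<lambda>g. inv\<^bsub>?S\<^esub> straighten \<otimes>\<^bsub>?S\<^esub> \<omega> g \<otimes>\<^bsub>?S\<^esub> straighten)"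
  have "\<mu> \<in> hom (braid_group k) ?S"
    unfolding \<mu>_def by (rule conj_hom[OF sym_group_is_group assms(3) c])
  moreover have "\<mu> (braid_gen k i) = psi m i" if "i \<in> {1..k-1}" for i
  proof -
    have "\<mu> (braid_gen k i) = inv' straighten \<circ> (?s i \<circ> straighten)"
      unfolding \<mu>_def sym_group_inv_equality[OF c] by (simp add: sym_group_mult comp_assoc)
    also have "\<dots> = (inv' straighten \<circ> straighten) \<circ> psi m i"
      unfolding comp_assoc by (subst straighten_psi) (use that in auto)
    also have "\<dots> = psi m i" using permutes_inv_o(2)[OF straighten_permutes] by simp
    finally show ?thesis .
  qed
  ultimately have "model_hom k m \<mu>" by (simp add: model_hom_def)
  moreover have "conjugate_homs (braid_group k) ?S \<omega> \<mu>"
    using c unfolding conjugate_homs_def \<mu>_def by blast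
  ultimately show ?thesis unfolding standard_hom_def by blast
qed

end
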